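(* Let $m\ge 1$ and let $n,k_1,\ldots,k_m$ be nonnegative integers such that $k_1+\cdots+k_m=n$. Put $s=k_1+1$. Then $$\binom{n}{k_1,\ldots,k_m}_q = \sum_{\substack{E\subseteq[n]\\ |E|=k_1}}\ \sum_{(r_{u,v})} q^{\sum_{u=1}^s\sum_{v=2}^m f(r_{u,v})}\binom{n_1}{0,r_{1,2},\ldots,r_{1,m}}_q\cdots\binom{n_s}{0,r_{s,2},\ldots,r_{s,m}}_q .$$ Here, for each $E=\{e_1,\ldots,e_{k_1}\}$ with $e_i<e_{i+1}$ for $1\le i\le k_1-1$: $n_1=e_1-1$; $n_i=e_i-e_{i-1}-1$ for $2\le i\le k_1$; and $n_s=n-e_{k_1}$ (if $k_1=0$, then $E=\emptyset$, $s=1$ and $n_1=n$). The inner sum is over all families of nonnegative integers $(r_{u,v})$, $u\in[s]$, $2\le v\le m$, such that $r_{u,2}+\cdots+r_{u,m}=n_u$ for every $u\in[s]$ and $r_{1,v}+\cdots+r_{s,v}=k_v$ for every $2\le v\le m$. Finally, $$f(r_{u,v}) = r_{u,v}\Big(k_1-u+1+\sum_{i=u+1}^{s}\sum_{j=2}^{v-1} r_{i,j}\Big)\qquad\text{for } u\in[s],\ 2\le v\le m.$$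
   Context: $[n]=\{1,\ldots,n\}$ and $q$ is an indeterminate. Empty sums are $0$. $q$-binomial coefficients: for nonnegative integers $n\ge k$, $\binom{n}{k}_q := \sum_{E\subseteq [n],\,|E|=k} q^{\sum_{i=1}^k ((n-e_i)-(k-i))}$, where $E=\{e_1<\cdots<e_k\}$. $q$-multinomial coefficients: for nonnegative integers with $k_1+\cdots+k_m=n$, $\binom{n}{k_1,\ldots,k_m}_q := \binom{n}{k_m}_q\binom{n-k_m}{k_{m-1}}_q\cdots\binom{n-k_m-\cdots-k_2}{k_1}_q$. *)

theory Defs
  imports "HOL-Computational_Algebra.Polynomial" "HOL-Library.FuncSet"
begin

text \<open>All identities live in the polynomial ring over the integers; \<open>qvar\<close> is its indeterminate.\<close>

abbreviation qvar :: "int poly" where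
  "qvar \<equiv> [:0, 1:]"

text \<open>Positions are counted from 1: \<open>nth_elem E i\<close> is the element \<open>e\<^sub>i\<close> of the finite set
  \<open>E = {e\<^sub>1 < \<dots> < e\<^sub>k}\<close>; it is only meaningful for \<open>1 \<le> i \<le> card E\<close>.\<close>

definition nth_elem :: "nat set \<Rightarrow> nat \<Rightarrow> nat" where
  "nth_elem E i = sorted_list_of_set E ! (i - 1)"

text \<open>The subtractions on naturals below never truncate: for \<open>E \<subseteq> {1..n}\<close> with \<open>card E = k\<close>
  one has \<open>e\<^sub>i \<le> n\<close>, \<open>i \<le> k\<close> and \<open>n - e\<^sub>i \<ge> k - i\<close>.\<close>

definition q_binomial :: "nat \<Rightarrow> nat \<Rightarrow> int poly" where
  "q_binomial n k =
     (\<Sum>E | E \<subseteq> {1..n} \<and> card E = k. qvar ^ (\<Sum>i=1..k. (n - nth_elem E i) - (k - i)))"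

text \<open>\<open>q_multinomial m n k\<close> has lower entries \<open>k 1, \<dots>, k m\<close> and is meant for
  \<open>(\<Sum>i=1..m. k i) = n\<close>; values of \<open>k\<close> outside \<open>{1..m}\<close> are irrelevant.\<close>

definition q_multinomial :: "nat \<Rightarrow> nat \<Rightarrow> (nat \<Rightarrow> nat) \<Rightarrow> int poly" where
  "q_multinomial m n k = (\<Prod>i=1..m. q_binomial (n - (\<Sum>j=i+1..m. k j)) (k i))"

text \<open>The sizes \<open>n\<^sub>1, \<dots>, n\<^sub>s\<close>, with \<open>s = card E + 1\<close>, of the blocks into which
  \<open>E \<subseteq> {1..n}\<close> cuts \<open>{1..n}\<close>.\<close>

definition gap :: "nat \<Rightarrow> nat set \<Rightarrow> nat \<Rightarrow> nat" where
  "gap n E u =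
     (if card E = 0 then n
      else if u = 1 then nth_elem E 1 - 1
      else if u \<le> card E then nth_elem E u - nth_elem E (u - 1) - 1
      else n - nth_elem E (card E))"

text \<open>The families \<open>(r u v)\<close> for \<open>1 \<le> u \<le> s\<close> and \<open>2 \<le> v \<le> m\<close>, with row sums \<open>N u\<close> and column
  sums \<open>k v\<close>. Taking extensional functions makes each family occur exactly once
  (exactly one empty family if \<open>m = 1\<close>).\<close>

definition families :: "nat \<Rightarrow> nat \<Rightarrow> (nat \<Rightarrow> nat) \<Rightarrow> (nat \<Rightarrow> nat) \<Rightarrow> (nat \<Rightarrow> nat \<Rightarrow> nat) set" where
  "families s m N k =
     {r \<in> {1..s} \<rightarrow>\<^sub>E ({2..m} \<rightarrow>\<^sub>E UNIV).
        (\<forall>u\<in>{1..s}. (\<Sum>v=2..m. r u v) = N u) \<and>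
        (\<forall>v\<in>{2..m}. (\<Sum>u=1..s. r u v) = k v)}"

lemma finite_families: "finite (families s m N k)"
proof (rule finite_subset)
  show "families s m N k \<subseteq> (\<Pi>\<^sub>E u\<in>{1..s}. \<Pi>\<^sub>E v\<in>{2..m}. {..N u})"
  proof
    fix r assume r: "r \<in> families s m N k"
    have "r u v \<le> N u" if "u \<in> {1..s}" "v \<in> {2..m}" for u v
    proof -
      have "r u v \<le> (\<Sum>v=2..m. r u v)"
        using that by (intro member_le_sum) auto
      then show ?thesis using r that by (simp add: families_def)
    qed
    with r show "r \<in> (\<Pi>\<^sub>E u\<in>{1..s}. \<Pi>\<^sub>E v\<in>{2..m}. {..N u})"
      unfolding families_def PiE_iff by (auto simp: PiE_iff)
  qed
qed (intro finite_PiE finite_atLeastAtMost finite_atMost)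

definition f_exp :: "nat \<Rightarrow> (nat \<Rightarrow> nat \<Rightarrow> nat) \<Rightarrow> nat \<Rightarrow> nat \<Rightarrow> nat" where
  "f_exp k1 r u v = r u v * ((k1 + 1 - u) + (\<Sum>i=u+1..k1+1. \<Sum>j=2..v-1. r i j))"

end

theory Submission
  imports Defs
begin

text \<open>
  The right-hand side counts words by inversions. A word with \<open>k\<^sub>v\<close> letters \<open>v\<close> is determined by the
  set \<open>E\<close> of positions of its letters 1 and by the words over \<open>2, \<dots>, m\<close> that fill the \<open>s = k\<^sub>1 + 1\<close>
  blocks between them; \<open>r u v\<close> is the number of letters \<open>v\<close> in block \<open>u\<close>. Letters in block \<open>u\<close>
  are inverted with the \<open>k\<^sub>1 + 1 - u\<close> later letters 1 and with the smaller letters of later blocks;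
  this is what \<open>f_exp\<close> records. The inversions inside a block are carried by its multinomial
  coefficient.

  The proof does not need words, because the two sources of inversions across blocks separate. As
  row \<open>u\<close> of \<open>r\<close> sums to the block size \<open>n\<^sub>u\<close>, the inversions with letters 1 contribute
  \<open>(\<Sum>u. (k\<^sub>1 + 1 - u) n\<^sub>u)\<close>, which depends on \<open>E\<close> only. For fixed \<open>E\<close> the sum over the families \<open>r\<close>
  is then an iterated Vandermonde convolution (\<open>q_multinomial_vandermonde\<close>), and its value, the
  multinomial coefficient of \<open>n - k\<^sub>1\<close> with lower entries \<open>0, k\<^sub>2, \<dots>, k\<^sub>m\<close>, no longer involves \<open>E\<close>.
  The remaining sum over \<open>E\<close> is the area generating function of lattice paths and equals the
  binomial coefficient of \<open>n\<close> over \<open>k\<^sub>1\<close> (\<open>sum_weighted_gap\<close>, \<open>q_binomial_eq_sum_area\<close>). Finally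
  \<open>q_multinomial_split_first\<close> says that the product of these two coefficients is the left-hand side.
\<close>

(* The indeterminate is a literal polynomial; these rules would rewrite products with it
   into coefficient lists and hide the powers of q. *)
declare mult_pCons_left [simp del] mult_pCons_right [simp del]

section \<open>Elements of a finite set of positions\<close>

lemma nth_elem_Suc_less:
  assumes "finite E" "1 \<le> i" "i < card E"
  shows "nth_elem E i < nth_elem E (Suc i)"
proof -
  have "sorted_list_of_set E ! (i - 1) < sorted_list_of_set E ! i"
    using assms strict_sorted_list_of_set[of E]
    by (simp add: sorted_wrt_iff_nth_less)
  then show ?thesis by (simp add: nth_elem_def)
qed

lemma nth_elem_mem:
  assumes "finite E" "1 \<le> i" "i \<le> card E"
  shows "nth_elem E i \<in> E"
proof -
  have "sorted_list_of_set E ! (i - 1) \<in> set (sorted_list_of_set E)"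
    using assms by (intro nth_mem) simp
  then show ?thesis using assms by (simp add: nth_elem_def)
qed

lemma nth_elem_add_le:
  assumes "finite E" "1 \<le> i" "i + d \<le> card E"
  shows "nth_elem E i + d \<le> nth_elem E (i + d)"
  using assms(3)
proof (induction d)
  case (Suc d)
  have "nth_elem E (i + d) < nth_elem E (Suc (i + d))"
    using assms(1,2) Suc.prems by (intro nth_elem_Suc_less) auto
  then show ?case using Suc by simp
qed simp

lemma nth_elem_bounds:
  assumes "E \<subseteq> {1..n}" "1 \<le> i" "i \<le> card E"
  shows "i \<le> nth_elem E i" "nth_elem E i + (card E - i) \<le> n"
proof -
  have fin: "finite E" using assms(1) by (rule finite_subset) simp
  have "nth_elem E 1 \<in> E" "nth_elem E (card E) \<in> E"
    using fin assms(2,3) by (auto intro!: nth_elem_mem)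
  then have "1 \<le> nth_elem E 1" "nth_elem E (card E) \<le> n"
    using assms(1) by auto
  moreover have "nth_elem E 1 + (i - 1) \<le> nth_elem E i"
    using nth_elem_add_le[of E 1 "i - 1"] fin assms by simp
  moreover have "nth_elem E i + (card E - i) \<le> nth_elem E (card E)"
    using nth_elem_add_le[of E i "card E - i"] fin assms by simp
  ultimately show "i \<le> nth_elem E i" "nth_elem E i + (card E - i) \<le> n"
    by linarith+
qed

lemma nth_elem_insert_max:
  assumes "E \<subseteq> {1..n}" "1 \<le> i" "i \<le> Suc (card E)"
  shows "nth_elem (insert (Suc n) E) i = (if i = Suc (card E) then Suc n else nth_elem E i)"
proof -
  have fin: "finite E" using assms(1) by (rule finite_subset) simp
  have "sorted_list_of_set (insert (Suc n) E) = sorted_list_of_set E @ [Suc n]"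
  proof (rule sorted_distinct_set_unique[OF sorted_sorted_list_of_set distinct_sorted_list_of_set])
    show "sorted (sorted_list_of_set E @ [Suc n])"
      using fin assms(1) by (auto simp: sorted_append)
    show "distinct (sorted_list_of_set E @ [Suc n])"
      using fin assms(1) by auto
  qed (use fin in \<open>simp del: sorted_list_of_set_insert_remove\<close>)
  then show ?thesis
    using assms(2,3) by (auto simp: nth_elem_def nth_append)
qed

text \<open>Splitting by whether the largest position is chosen is the source of both Pascal recursions:
  \<open>F\<close> will be a power of the indeterminate, once for each of the two statistics on subsets.\<close>

lemma sum_subsets_card_Suc:
  fixes F :: "nat set \<Rightarrow> 'a :: comm_monoid_add"
  shows "(\<Sum>E | E \<subseteq> {1..Suc n} \<and> card E = Suc k. F E) =
    (\<Sum>E | E \<subseteq> {1..n} \<and> card E = k. F (insert (Suc n) E)) +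
    (\<Sum>E | E \<subseteq> {1..n} \<and> card E = Suc k. F E)"
proof -
  let ?A = "{E. E \<subseteq> {1..n} \<and> card E = k}" and ?B = "{E. E \<subseteq> {1..n} \<and> card E = Suc k}"
  have fin: "finite E" if "E \<subseteq> {1..n}" for E
    using that by (rule finite_subset) simp
  have notin: "Suc n \<notin> E" if "E \<subseteq> {1..n}" for E
    using that by auto
  have "{E. E \<subseteq> {1..Suc n} \<and> card E = Suc k} = insert (Suc n) ` ?A \<union> ?B" (is "?L = ?R")
  proof (intro set_eqI iffI)
    fix E assume E: "E \<in> ?L"
    show "E \<in> ?R"
    proof (cases "Suc n \<in> E")
      case True
      have "finite E" using E by (auto intro: finite_subset)
      then have "card (E - {Suc n}) = k" using E True by simp
      moreover have "E - {Suc n} \<subseteq> {1..n}" using E by (auto simp: le_Suc_eq)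
      moreover have "E = insert (Suc n) (E - {Suc n})" using True by auto
      ultimately show ?thesis by blast
    next
      case False
      then have "E \<subseteq> {1..n}" using E by (auto simp: le_Suc_eq)
      then show ?thesis using E by simp
    qed
  next
    fix E assume "E \<in> ?R"
    then show "E \<in> ?L" using fin notin by (auto simp: subset_iff)
  qed
  moreover have "inj_on (insert (Suc n)) ?A"
    using notin by (intro inj_onI) (simp add: insert_ident)
  moreover have "insert (Suc n) ` ?A \<inter> ?B = {}" by auto
  moreover have "finite ?A" "finite ?B" by simp_all
  ultimately show ?thesis
    by (simp add: sum.union_disjoint sum.reindex)
qed

section \<open>Gaussian binomial coefficients\<close>

lemma q_binomial_0_right [simp]: "q_binomial n 0 = 1"
proof -
  have "card E = 0 \<longleftrightarrow> E = {}" if "E \<subseteq> {1..n}" for E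
    using finite_subset[OF that] by simp
  then have "{E. E \<subseteq> {1..n} \<and> card E = 0} = {{}}" by auto
  then show ?thesis by (simp add: q_binomial_def)
qed

lemma q_binomial_eq_0: "n < k \<Longrightarrow> q_binomial n k = 0"
proof -
  assume "n < k"
  then have "card E \<noteq> k" if "E \<subseteq> {1..n}" for E
    using card_mono[OF _ that] by simp
  then have "{E. E \<subseteq> {1..n} \<and> card E = k} = {}" by blast
  then show ?thesis unfolding q_binomial_def by (simp only: sum.empty)
qed

text \<open>If \<open>n + 1\<close> is chosen, it has nothing after it and shifts both \<open>n\<close> and \<open>k\<close> for the other
  chosen positions, so the weight is unchanged; if not, each of the \<open>k + 1\<close> chosen positions gains
  one later position that is not chosen.\<close>

lemma q_binomial_Suc_Suc:
  "q_binomial (Suc n) (Suc k) = q_binomial n k + qvar ^ Suc k * q_binomial n (Suc k)"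
proof -
  let ?e = "\<lambda>n k E. (\<Sum>i=1..k. (n - nth_elem E i) - (k - i))"
  have with_max: "?e (Suc n) (Suc k) (insert (Suc n) E) = ?e n k E"
    if "E \<subseteq> {1..n}" "card E = k" for E
    using that by (auto simp: nth_elem_insert_max intro!: sum.cong)
  have without_max: "?e (Suc n) (Suc k) E = Suc k + ?e n (Suc k) E"
    if "E \<subseteq> {1..n}" "card E = Suc k" for E
  proof -
    have "?e (Suc n) (Suc k) E = (\<Sum>i=1..Suc k. 1 + ((n - nth_elem E i) - (Suc k - i)))"
    proof (rule sum.cong)
      fix i assume "i \<in> {1..Suc k}"
      then show "Suc n - nth_elem E i - (Suc k - i) = 1 + (n - nth_elem E i - (Suc k - i))"
        using nth_elem_bounds(2)[of E n i] that by simp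
    qed simp
    also have "\<dots> = Suc k + ?e n (Suc k) E"
      by (simp only: sum.distrib) simp
    finally show ?thesis .
  qed
  show ?thesis
    unfolding q_binomial_def sum_subsets_card_Suc sum_distrib_left
    by (intro arg_cong2[where f = "(+)"] sum.cong refl)
      (simp_all only: mem_Collect_eq with_max without_max power_add)
qed

text \<open>Numerator and denominators of Gaussian binomials in product form. Compared with the usual
  \<open>q\<close>-factorial, the factors \<open>q - 1\<close> are kept; they cancel in all quotients, and without division the
  recursions reduce to identities between powers of \<open>q\<close>.\<close>

definition q_factorial :: "nat \<Rightarrow> int poly" where
  "q_factorial n = (\<Prod>i=1..n. qvar ^ i - 1)"

lemma q_factorial_0 [simp]: "q_factorial 0 = 1"
  by (simp add: q_factorial_def)

lemma q_factorial_Suc: "q_factorial (Suc n) = (qvar ^ Suc n - 1) * q_factorial n"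
  by (simp add: q_factorial_def mult.commute)

lemma q_factorial_nonzero: "q_factorial n \<noteq> 0"
proof -
  have "qvar ^ i - 1 \<noteq> 0" if "1 \<le> i" for i
  proof
    assume "qvar ^ i - 1 = 0"
    then have "degree (qvar ^ i) = degree (1 :: int poly)" by simp
    then show False using that by (simp add: degree_power_eq)
  qed
  then show ?thesis by (simp add: q_factorial_def)
qed

text \<open>Induction with the Pascal recursion: it comes down to
  \<open>q\<^bsup>n+1\<^esup> - 1 = (q\<^bsup>j+1\<^esup> - 1) + q\<^bsup>j+1\<^esup> (q\<^bsup>n-j\<^esup> - 1)\<close>. As \<open>int poly\<close> is an integral domain, symmetry and
  trinomial revision follow by cancelling.\<close>

lemma q_binomial_factorial:
  "k \<le> n \<Longrightarrow> q_binomial n k * q_factorial k * q_factorial (n - k) = q_factorial n"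
proof (induction n arbitrary: k)
  case (Suc n)
  show ?case
  proof (cases k)
    case (Suc j)
    then have j: "j \<le> n" using Suc.prems by simp
    have first: "q_binomial n j * q_factorial (Suc j) * q_factorial (n - j) =
        (qvar ^ Suc j - 1) * q_factorial n"
      using Suc.IH[OF j] by (simp add: q_factorial_Suc algebra_simps)
    have second: "q_binomial n (Suc j) * q_factorial (Suc j) * q_factorial (n - j) =
        (qvar ^ (n - j) - 1) * q_factorial n"
    proof (cases "j = n")
      case True
      then show ?thesis by (simp add: q_binomial_eq_0)
    next
      case False
      then have d: "n - j = Suc (n - Suc j)" and le: "Suc j \<le> n" using j by auto
      show ?thesis
        unfolding Suc.IH[OF le, symmetric] d q_factorial_Suc[of "n - Suc j"] by (simp only: mult_ac)
    qed
    have "q_binomial (Suc n) k * q_factorial k * q_factorial (Suc n - k) =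
        (qvar ^ Suc j - 1) * q_factorial n + qvar ^ Suc j * ((qvar ^ (n - j) - 1) * q_factorial n)"
      unfolding first[symmetric] second[symmetric] Suc q_binomial_Suc_Suc
      by (simp add: algebra_simps)
    also have "\<dots> = (qvar ^ (Suc j + (n - j)) - 1) * q_factorial n"
      unfolding power_add by (simp add: algebra_simps)
    also have "\<dots> = q_factorial (Suc n)"
      using j by (simp add: q_factorial_Suc)
    finally show ?thesis .
  qed simp
qed simp

lemma q_binomial_self [simp]: "q_binomial n n = 1"
  using q_binomial_factorial[of n n] q_factorial_nonzero[of n] by simp

lemma q_binomial_symmetric:
  assumes "k \<le> n"
  shows "q_binomial n (n - k) = q_binomial n k"
proof -
  have "q_binomial n (n - k) * (q_factorial k * q_factorial (n - k)) =
      q_binomial n k * (q_factorial k * q_factorial (n - k))"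
    using q_binomial_factorial[OF assms] q_binomial_factorial[of "n - k" n] assms
    by (simp add: algebra_simps)
  then show ?thesis by (simp add: q_factorial_nonzero)
qed

text \<open>The mirror image of the first Pascal recursion, obtained from it by symmetry.\<close>

lemma q_binomial_Suc_Suc':
  assumes "k \<le> n"
  shows "q_binomial (Suc n) (Suc k) = qvar ^ (n - k) * q_binomial n k + q_binomial n (Suc k)"
proof (cases "k = n")
  case True
  then show ?thesis by (simp add: q_binomial_eq_0)
next
  case False
  then have k: "Suc k \<le> n" and d: "n - k = Suc (n - Suc k)" using assms by auto
  have "q_binomial (Suc n) (Suc k) = q_binomial (Suc n) (n - k)"
    using q_binomial_symmetric[of "Suc k" "Suc n"] assms by simp
  also have "\<dots> = q_binomial n (n - Suc k) + qvar ^ (n - k) * q_binomial n (n - k)"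
    unfolding d by (rule q_binomial_Suc_Suc)
  finally show ?thesis
    using k by (simp add: q_binomial_symmetric)
qed

text \<open>Both sides are the trinomial coefficient with lower entries \<open>a\<close>, \<open>b\<close> and \<open>n - a - b\<close>: whether
  \<open>a\<close> or \<open>b\<close> is extracted first does not matter.\<close>

lemma q_binomial_revision:
  assumes "a + b \<le> n"
  shows "q_binomial n a * q_binomial (n - a) b = q_binomial n b * q_binomial (n - b) a"
proof -
  let ?d = "q_factorial a * q_factorial b * q_factorial (n - a - b)"
  have "q_binomial n a * q_binomial (n - a) b * ?d =
      q_binomial n a * q_factorial a *
        (q_binomial (n - a) b * q_factorial b * q_factorial (n - a - b))"
    by (simp only: mult_ac)
  also have "\<dots> = q_factorial n"
    using assms q_binomial_factorial[of a n] q_binomial_factorial[of b "n - a"] by simp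
  also have "\<dots> = q_binomial n b * q_factorial b *
        (q_binomial (n - b) a * q_factorial a * q_factorial (n - b - a))"
    using assms q_binomial_factorial[of b n] q_binomial_factorial[of a "n - b"]
    by (simp add: add.commute)
  also have "\<dots> = q_binomial n b * q_binomial (n - b) a * ?d"
    by (simp only: mult_ac diff_commute)
  finally show ?thesis by (simp add: q_factorial_nonzero)
qed

text \<open>Of the \<open>k\<close> larger letters, \<open>j\<close> go to the first block; they are inverted with the \<open>b - (k - j)\<close>
  smaller letters of the second. The proof applies the Pascal recursion to the second block. Where the
  subtraction in the exponent truncates, the factor \<open>q_binomial b (k - j)\<close> vanishes.\<close>

lemma q_vandermonde:
  "q_binomial (a + b) k =
    (\<Sum>j\<le>k. q_binomial a j * q_binomial b (k - j) * qvar ^ (j * (b - (k - j))))"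
proof (induction b arbitrary: k)
  case 0
  have "(\<Sum>j\<le>k. q_binomial a j * q_binomial 0 (k - j) * qvar ^ (j * (0 - (k - j)))) =
      (\<Sum>j\<le>k. if j = k then q_binomial a k else 0)"
    by (intro sum.cong) (auto simp: q_binomial_eq_0)
  then show ?case by simp
next
  case (Suc b)
  let ?t = "\<lambda>b k j. q_binomial a j * q_binomial b (k - j) * qvar ^ (j * (b - (k - j)))"
  show ?case
  proof (cases k)
    case (Suc l)
    have step: "?t (Suc b) (Suc l) j = ?t b l j + qvar ^ Suc l * ?t b (Suc l) j" if "j \<le> l" for j
    proof (cases "Suc (l - j) \<le> b")
      case True
      have "(l - j + 1) + j * (b - (l - j)) = Suc l + j * (b - Suc (l - j))"
      proof -
        obtain c where "b = Suc (l - j) + c" using True le_Suc_ex by blast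
        then show ?thesis using that by simp
      qed
      then have "qvar ^ Suc (l - j) * qvar ^ (j * (b - (l - j))) =
          qvar ^ Suc l * qvar ^ (j * (b - Suc (l - j)))"
        by (simp only: power_add[symmetric] Suc_eq_plus1)
      then show ?thesis
        using that by (simp add: Suc_diff_le q_binomial_Suc_Suc algebra_simps)
    next
      case False
      then have "q_binomial b (Suc (l - j)) = 0" by (simp add: q_binomial_eq_0)
      then show ?thesis
        using that by (simp add: Suc_diff_le q_binomial_Suc_Suc)
    qed
    have last: "?t (Suc b) (Suc l) (Suc l) = qvar ^ Suc l * ?t b (Suc l) (Suc l)"
      by (simp add: power_add algebra_simps)
    have "(\<Sum>j\<le>k. ?t (Suc b) k j) =
        (\<Sum>j\<le>l. ?t (Suc b) (Suc l) j) + ?t (Suc b) (Suc l) (Suc l)"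
      by (simp add: Suc)
    also have "\<dots> = (\<Sum>j\<le>l. ?t b l j + qvar ^ Suc l * ?t b (Suc l) j)
        + qvar ^ Suc l * ?t b (Suc l) (Suc l)"
      using step last by simp
    also have "\<dots> = (\<Sum>j\<le>l. ?t b l j) + qvar ^ Suc l * (\<Sum>j\<le>Suc l. ?t b (Suc l) j)"
      by (simp add: sum.distrib sum_distrib_left algebra_simps)
    also have "\<dots> = q_binomial (a + b) l + qvar ^ Suc l * q_binomial (a + b) (Suc l)"
      by (simp only: Suc.IH)
    finally show ?thesis
      by (simp add: Suc q_binomial_Suc_Suc)
  qed simp
qed

section \<open>Gaussian Vandermonde convolution over several blocks\<close>

text \<open>The ways to distribute \<open>k\<close> equal letters over \<open>s\<close> blocks with capacities \<open>N\<close>. The bound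
  \<open>c u \<le> N u\<close> loses nothing, since larger entries have vanishing binomial coefficients, but it keeps
  the subtractions \<open>N u - c u\<close> exact.\<close>

definition block_choices :: "nat \<Rightarrow> (nat \<Rightarrow> nat) \<Rightarrow> nat \<Rightarrow> (nat \<Rightarrow> nat) set" where
  "block_choices s N k = {c \<in> (\<Pi>\<^sub>E u\<in>{1..s}. {..N u}). (\<Sum>u=1..s. c u) = k}"

lemma finite_block_choices [simp]: "finite (block_choices s N k)"
proof (rule finite_subset)
  show "block_choices s N k \<subseteq> (\<Pi>\<^sub>E u\<in>{1..s}. {..N u})"
    by (auto simp: block_choices_def)
qed (intro finite_PiE finite_atLeastAtMost finite_atMost)

lemma sum_block_choices_Suc:
  fixes F :: "(nat \<Rightarrow> nat) \<Rightarrow> 'a :: comm_monoid_add"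
  shows "(\<Sum>c\<in>block_choices (Suc s) N k. F c) =
    (\<Sum>d\<le>min k (N (Suc s)). \<Sum>c\<in>block_choices s N (k - d). F (c(Suc s := d)))"
proof -
  have "(\<Sum>c\<in>block_choices (Suc s) N k. F c) =
      (\<Sum>(d, c)\<in>(SIGMA d:{..min k (N (Suc s))}. block_choices s N (k - d)). F (c(Suc s := d)))"
    by (rule sum.reindex_bij_witness[where
          i = "\<lambda>(d, c). c(Suc s := d)" and
          j = "\<lambda>c. (c (Suc s), c(Suc s := undefined))"])
      (auto simp: block_choices_def PiE_iff extensional_def)
  then show ?thesis by (simp add: sum.Sigma)
qed

text \<open>A new last block is later than every other block, so it adds one term for each of them.\<close>

lemma sum_up_to_Suc_pairs:
  fixes a b :: "nat \<Rightarrow> nat"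
  shows "(\<Sum>u=1..Suc s. a u * (\<Sum>i=u+1..Suc s. b i)) =
    (\<Sum>u=1..s. a u * (\<Sum>i=u+1..s. b i)) + (\<Sum>u=1..s. a u) * b (Suc s)"
proof -
  have "(\<Sum>u=1..s. a u * (\<Sum>i=u+1..Suc s. b i)) =
      (\<Sum>u=1..s. a u * (\<Sum>i=u+1..s. b i) + a u * b (Suc s))"
    by (intro sum.cong) (auto simp: algebra_simps)
  then show ?thesis by (simp add: sum.distrib sum_distrib_right)
qed

text \<open>Splitting off the last block, the exponent grows by the product of the \<open>k - d\<close> letters placed in
  earlier blocks and the \<open>N (Suc s) - d\<close> other places of the last one. This is the exponent of the
  convolution of two blocks, the first being the union of all earlier ones.\<close>

lemma q_vandermonde_blocks:
  "(\<Sum>c\<in>block_choices s N k.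
      qvar ^ (\<Sum>u=1..s. c u * (\<Sum>i=u+1..s. N i - c i)) * (\<Prod>u=1..s. q_binomial (N u) (c u))) =
    q_binomial (\<Sum>u=1..s. N u) k"
proof (induction s arbitrary: k)
  case 0
  show ?case
    by (cases k) (auto simp: block_choices_def q_binomial_eq_0)
next
  case (Suc s)
  let ?w = "\<lambda>s c. qvar ^ (\<Sum>u=1..s. c u * (\<Sum>i=u+1..s. N i - c i)) *
    (\<Prod>u=1..s. q_binomial (N u) (c u))"
  let ?N = "\<Sum>u=1..s. N u" and ?b = "N (Suc s)"
  have step: "?w (Suc s) (c(Suc s := d)) =
      q_binomial ?b d * qvar ^ ((k - d) * (?b - d)) * ?w s c"
    if "c \<in> block_choices s N (k - d)" for c d
  proof -
    let ?c = "c(Suc s := d)"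
    have "(\<Sum>u=1..Suc s. ?c u * (\<Sum>i=u+1..Suc s. N i - ?c i)) =
        (\<Sum>u=1..s. ?c u * (\<Sum>i=u+1..s. N i - ?c i)) + (\<Sum>u=1..s. ?c u) * (?b - d)"
      by (subst sum_up_to_Suc_pairs) simp
    also have "(\<Sum>u=1..s. ?c u) = k - d"
      using that by (simp add: block_choices_def)
    also have "(\<Sum>u=1..s. ?c u * (\<Sum>i=u+1..s. N i - ?c i)) =
        (\<Sum>u=1..s. c u * (\<Sum>i=u+1..s. N i - c i))"
      by (intro sum.cong arg_cong2[where f = "(*)"]) auto
    finally have e: "(\<Sum>u=1..Suc s. ?c u * (\<Sum>i=u+1..Suc s. N i - ?c i)) =
      (\<Sum>u=1..s. c u * (\<Sum>i=u+1..s. N i - c i)) + (k - d) * (?b - d)" .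
    have p: "(\<Prod>u=1..Suc s. q_binomial (N u) (?c u)) =
        q_binomial ?b d * (\<Prod>u=1..s. q_binomial (N u) (c u))"
      by (simp add: mult.commute)
    show ?thesis unfolding e p by (simp add: power_add mult_ac)
  qed
  have last_block: "(\<Sum>c\<in>block_choices s N (k - d). ?w (Suc s) (c(Suc s := d))) =
      q_binomial ?b d * qvar ^ ((k - d) * (?b - d)) * q_binomial ?N (k - d)" for d
  proof -
    have "(\<Sum>c\<in>block_choices s N (k - d). ?w (Suc s) (c(Suc s := d))) =
        (\<Sum>c\<in>block_choices s N (k - d).
          q_binomial ?b d * qvar ^ ((k - d) * (?b - d)) * ?w s c)"
      by (intro sum.cong refl step)
    then show ?thesis unfolding sum_distrib_left[symmetric] Suc.IH .
  qed
  have "(\<Sum>c\<in>block_choices (Suc s) N k. ?w (Suc s) c) =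
      (\<Sum>d\<le>min k ?b. q_binomial ?b d * qvar ^ ((k - d) * (?b - d)) * q_binomial ?N (k - d))"
    unfolding sum_block_choices_Suc last_block ..
  also have "\<dots> = (\<Sum>d\<le>k. q_binomial ?b d * qvar ^ ((k - d) * (?b - d)) * q_binomial ?N (k - d))"
    by (intro sum.mono_neutral_left) (auto simp: q_binomial_eq_0)
  also have "\<dots> = (\<Sum>j\<le>k. q_binomial ?N j * q_binomial ?b (k - j) * qvar ^ (j * (?b - (k - j))))"
    by (rule sum.reindex_bij_witness[where i = "\<lambda>j. k - j" and j = "\<lambda>d. k - d"])
      (auto simp: mult_ac)
  also have "\<dots> = q_binomial (?N + ?b) k"
    by (rule q_vandermonde[symmetric])
  finally show ?case by simp
qed

section \<open>Gaussian multinomial coefficients\<close>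

lemma q_multinomial_Suc:
  "q_multinomial (Suc m) n k = q_binomial n (k (Suc m)) * q_multinomial m (n - k (Suc m)) k"
proof -
  have "(\<Prod>i=1..m. q_binomial (n - (\<Sum>j=i+1..Suc m. k j)) (k i)) =
      (\<Prod>i=1..m. q_binomial (n - k (Suc m) - (\<Sum>j=i+1..m. k j)) (k i))"
    by (intro prod.cong) (auto simp: add.commute)
  then show ?thesis by (simp add: q_multinomial_def mult.commute)
qed

lemma q_multinomial_cong:
  assumes "\<And>i. 1 \<le> i \<Longrightarrow> i \<le> m \<Longrightarrow> k i = l i"
  shows "q_multinomial m n k = q_multinomial m n l"
  unfolding q_multinomial_def using assms
  by (intro prod.cong refl arg_cong2[where f = q_binomial] arg_cong2[where f = "(-)"] sum.cong) auto

text \<open>The definition extracts \<open>k 1\<close> last; trinomial revision moves it past \<open>k m, \<dots>, k 2\<close> one by one.\<close>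

lemma q_multinomial_split_first:
  assumes "1 \<le> m" "(\<Sum>i=1..m. k i) = n"
  shows "q_multinomial m n k = q_binomial n (k 1) * q_multinomial m (n - k 1) (k(1 := 0))"
  using assms
proof (induction m arbitrary: n rule: dec_induct)
  case base
  then show ?case by (simp add: q_multinomial_def)
next
  case (step m)
  let ?c = "k (Suc m)"
  have "k 1 \<le> (\<Sum>i=1..m. k i)"
    using step.hyps by (intro member_le_sum) auto
  then have le: "?c + k 1 \<le> n" using step.prems by simp
  have ne: "Suc m \<noteq> 1" using step.hyps by simp
  have "(\<Sum>i=1..m. k i) = n - ?c" using step.prems by simp
  then have IH: "q_multinomial m (n - ?c) k =
      q_binomial (n - ?c) (k 1) * q_multinomial m (n - ?c - k 1) (k(1 := 0))"
    by (rule step.IH)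
  have "q_multinomial (Suc m) n k =
      q_binomial n ?c * q_binomial (n - ?c) (k 1) * q_multinomial m (n - ?c - k 1) (k(1 := 0))"
    unfolding q_multinomial_Suc IH mult.assoc ..
  also have "q_binomial n ?c * q_binomial (n - ?c) (k 1) =
      q_binomial n (k 1) * q_binomial (n - k 1) ?c"
    using le by (rule q_binomial_revision)
  finally show ?case
    using ne by (simp add: q_multinomial_Suc mult.assoc add.commute)
qed

text \<open>The inversions between letters \<open>2, \<dots>, m\<close> in different blocks when block \<open>u\<close> contains \<open>r u v\<close>
  letters \<open>v\<close>.\<close>

definition cross_inversions :: "nat \<Rightarrow> nat \<Rightarrow> (nat \<Rightarrow> nat \<Rightarrow> nat) \<Rightarrow> nat" where
  "cross_inversions s m r =
    (\<Sum>u=1..s. \<Sum>v=2..m. r u v * (\<Sum>i=u+1..s. \<Sum>j=2..v-1. r i j))"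

text \<open>The last column of a family is a way to distribute the largest letter; removing it leaves a
  family for the remaining places of each block.\<close>

lemma sum_families_Suc:
  fixes F :: "(nat \<Rightarrow> nat \<Rightarrow> nat) \<Rightarrow> 'a :: comm_monoid_add"
  assumes "1 \<le> m"
  shows "(\<Sum>r\<in>families s (Suc m) N k. F r) =
    (\<Sum>c\<in>block_choices s N (k (Suc m)). \<Sum>r\<in>families s m (\<lambda>u. N u - c u) k.
      F (\<lambda>u\<in>{1..s}. (r u)(Suc m := c u)))"
proof -
  let ?S = "SIGMA c:block_choices s N (k (Suc m)). families s m (\<lambda>u. N u - c u) k"
  let ?i = "\<lambda>(c, r). \<lambda>u\<in>{1..s}. (r u)(Suc m := c u)"
  let ?j = "\<lambda>r. (\<lambda>u\<in>{1..s}. r u (Suc m), \<lambda>u\<in>{1..s}. (r u)(Suc m := undefined))"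
  have ivl: "{2..Suc m} = insert (Suc m) {2..m}" using assms by auto
  have "(\<Sum>r\<in>families s (Suc m) N k. F r) = (\<Sum>(c, r)\<in>?S. F (?i (c, r)))"
  proof (rule sum.reindex_bij_witness[where i = ?i and j = ?j])
    fix r assume r: "r \<in> families s (Suc m) N k"
    then have row: "(\<Sum>v=2..m. r u v) + r u (Suc m) = N u" if "1 \<le> u" "u \<le> s" for u
      using that assms by (simp add: families_def ivl add.commute)
    show "?i (?j r) = r"
      using r by (auto simp: families_def PiE_iff extensional_def fun_eq_iff)
    show "?j r \<in> ?S"
    proof -
      have "r u (Suc m) \<le> N u" "(\<Sum>v=2..m. r u v) = N u - r u (Suc m)"
        if "1 \<le> u" "u \<le> s" for u
        using row[OF that] by auto
      then show ?thesis
        using r assms by (auto simp: families_def block_choices_def PiE_iff extensional_def)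
    qed
    show "(case ?j r of (c, r) \<Rightarrow> F (?i (c, r))) = F r"
      using \<open>?i (?j r) = r\<close> by simp
  next
    fix x assume "x \<in> ?S"
    then obtain c r where x: "x = (c, r)" and c: "c \<in> block_choices s N (k (Suc m))"
      and r: "r \<in> families s m (\<lambda>u. N u - c u) k" by auto
    show "?j (?i x) = x"
      using c r unfolding x
      by (auto simp: families_def block_choices_def PiE_iff extensional_def fun_eq_iff)
    show "?i x \<in> families s (Suc m) N k"
      using c r assms unfolding x
      by (auto simp: families_def block_choices_def PiE_iff extensional_def ivl)
  qed
  then show ?thesis by (simp add: sum.Sigma finite_families)
qed

text \<open>A new largest letter is inverted with all other letters of later blocks, and block \<open>i\<close> has
  \<open>N i - c i\<close> of them, however they are arranged.\<close>

lemma cross_inversions_Suc: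
  assumes "1 \<le> m" "r \<in> families s m (\<lambda>u. N u - c u) k"
  shows "cross_inversions s (Suc m) (\<lambda>u\<in>{1..s}. (r u)(Suc m := c u)) =
    (\<Sum>u=1..s. c u * (\<Sum>i=u+1..s. N i - c i)) + cross_inversions s m r"
proof -
  let ?r = "\<lambda>u\<in>{1..s}. (r u)(Suc m := c u)"
  have ivl: "{2..Suc m} = insert (Suc m) {2..m}" using assms(1) by auto
  have inner: "(\<Sum>i=u+1..s. \<Sum>j=2..v-1. ?r i j) = (\<Sum>i=u+1..s. \<Sum>j=2..v-1. r i j)"
    if "v \<le> Suc m" for u v
    using that by (intro sum.cong) auto
  have rows: "(\<Sum>i=u+1..s. \<Sum>j=2..m. r i j) = (\<Sum>i=u+1..s. N i - c i)" for u
    using assms(2) by (intro sum.cong) (auto simp: families_def)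
  have "cross_inversions s (Suc m) ?r =
      (\<Sum>u=1..s. c u * (\<Sum>i=u+1..s. N i - c i) +
        (\<Sum>v=2..m. r u v * (\<Sum>i=u+1..s. \<Sum>j=2..v-1. r i j)))"
    unfolding cross_inversions_def
  proof (intro sum.cong refl)
    fix u assume u: "u \<in> {1..s}"
    have "(\<Sum>v=2..Suc m. ?r u v * (\<Sum>i=u+1..s. \<Sum>j=2..v-1. ?r i j)) =
        (\<Sum>v=2..Suc m. ?r u v * (\<Sum>i=u+1..s. \<Sum>j=2..v-1. r i j))"
      using inner by (intro sum.cong arg_cong2[where f = "(*)"]) auto
    also have "\<dots> = c u * (\<Sum>i=u+1..s. \<Sum>j=2..m. r i j) +
        (\<Sum>v=2..m. ?r u v * (\<Sum>i=u+1..s. \<Sum>j=2..v-1. r i j))"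
      using u unfolding ivl by simp
    also have "(\<Sum>v=2..m. ?r u v * (\<Sum>i=u+1..s. \<Sum>j=2..v-1. r i j)) =
        (\<Sum>v=2..m. r u v * (\<Sum>i=u+1..s. \<Sum>j=2..v-1. r i j))"
      using u by (intro sum.cong) auto
    finally show "(\<Sum>v=2..Suc m. ?r u v * (\<Sum>i=u+1..s. \<Sum>j=2..v-1. ?r i j)) =
        c u * (\<Sum>i=u+1..s. N i - c i) +
        (\<Sum>v=2..m. r u v * (\<Sum>i=u+1..s. \<Sum>j=2..v-1. r i j))"
      unfolding rows .
  qed
  then show ?thesis by (simp add: sum.distrib cross_inversions_def)
qed

text \<open>The Vandermonde convolution for multinomials. The largest letter is removed first: the
  exponent and each block's multinomial coefficient then split into a factor that depends only on its
  distribution \<open>c\<close> and a factor of the same shape for one letter less. By induction the inner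
  sum does not depend on \<open>c\<close>, and the sum over \<open>c\<close> is \<open>q_vandermonde_blocks\<close>.\<close>

lemma q_multinomial_vandermonde:
  assumes "1 \<le> m" "(\<Sum>u=1..s. N u) = (\<Sum>v=2..m. k v)"
  shows "(\<Sum>r\<in>families s m N k.
      qvar ^ cross_inversions s m r * (\<Prod>u=1..s. q_multinomial m (N u) ((r u)(1 := 0)))) =
    q_multinomial m (\<Sum>u=1..s. N u) (k(1 := 0))"
  using assms
proof (induction m arbitrary: N rule: dec_induct)
  case base
  then have N: "N u = 0" if "u \<in> {1..s}" for u using that by simp
  (* With no columns there is exactly one family, as all blocks are empty. *)
  have "families s 1 N k = {\<lambda>u\<in>{1..s}. \<lambda>_. undefined}"
    using N by (auto simp: families_def PiE_iff extensional_def fun_eq_iff)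
  then show ?case
    using N by (simp add: cross_inversions_def q_multinomial_def)
next
  case (step m)
  let ?c = "k (Suc m)"
  let ?w = "\<lambda>m N r. qvar ^ cross_inversions s m r *
    (\<Prod>u=1..s. q_multinomial m (N u) ((r u)(1 := 0)))"
  let ?v = "\<lambda>c. qvar ^ (\<Sum>u=1..s. c u * (\<Sum>i=u+1..s. N i - c i)) *
    (\<Prod>u=1..s. q_binomial (N u) (c u))"
  have factor: "?w (Suc m) N (\<lambda>u\<in>{1..s}. (r u)(Suc m := c u)) = ?v c * ?w m (\<lambda>u. N u - c u) r"
    if r: "r \<in> families s m (\<lambda>u. N u - c u) k" for c r
  proof -
    let ?r = "\<lambda>u\<in>{1..s}. (r u)(Suc m := c u)"
    have "q_multinomial (Suc m) (N u) ((?r u)(1 := 0)) =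
        q_binomial (N u) (c u) * q_multinomial m (N u - c u) ((r u)(1 := 0))"
      if "u \<in> {1..s}" for u
    proof -
      have "q_multinomial m (N u - c u) ((?r u)(1 := 0)) =
          q_multinomial m (N u - c u) ((r u)(1 := 0))"
        using that by (intro q_multinomial_cong) auto
      then show ?thesis
        using that step.hyps by (simp add: q_multinomial_Suc)
    qed
    then have "(\<Prod>u=1..s. q_multinomial (Suc m) (N u) ((?r u)(1 := 0))) =
        (\<Prod>u=1..s. q_binomial (N u) (c u)) *
        (\<Prod>u=1..s. q_multinomial m (N u - c u) ((r u)(1 := 0)))"
      by (simp add: prod.distrib)
    then show ?thesis
      unfolding cross_inversions_Suc[OF step.hyps(1) r] power_add by (simp only: mult_ac)
  qed
  have ivl: "{2..Suc m} = insert (Suc m) {2..m}" using step.hyps by auto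
  have IH: "(\<Sum>r\<in>families s m (\<lambda>u. N u - c u) k. ?w m (\<lambda>u. N u - c u) r) =
      q_multinomial m ((\<Sum>u=1..s. N u) - ?c) (k(1 := 0))"
    if "c \<in> block_choices s N ?c" for c
  proof -
    have "(\<Sum>u=1..s. N u - c u) = (\<Sum>u=1..s. N u) - (\<Sum>u=1..s. c u)"
      using that by (intro sum_subtractf_nat) (auto simp: block_choices_def PiE_iff)
    also have "(\<Sum>u=1..s. c u) = ?c"
      using that by (simp add: block_choices_def)
    finally have tot: "(\<Sum>u=1..s. N u - c u) = (\<Sum>u=1..s. N u) - ?c" .
    also have "\<dots> = (\<Sum>v=2..m. k v)"
      using step.prems unfolding ivl by simp
    finally show ?thesis
      using step.IH[of "\<lambda>u. N u - c u"] unfolding tot by blast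
  qed
  have "(\<Sum>r\<in>families s (Suc m) N k. ?w (Suc m) N r) =
      (\<Sum>c\<in>block_choices s N ?c. \<Sum>r\<in>families s m (\<lambda>u. N u - c u) k.
        ?v c * ?w m (\<lambda>u. N u - c u) r)"
    unfolding sum_families_Suc[OF step.hyps(1)] by (intro sum.cong refl factor)
  also have "\<dots> = (\<Sum>c\<in>block_choices s N ?c.
      ?v c * q_multinomial m ((\<Sum>u=1..s. N u) - ?c) (k(1 := 0)))"
    unfolding sum_distrib_left[symmetric] by (intro sum.cong refl arg_cong2[where f = "(*)"] IH)
  also have "\<dots> = q_binomial (\<Sum>u=1..s. N u) ?c *
      q_multinomial m ((\<Sum>u=1..s. N u) - ?c) (k(1 := 0))"
    unfolding sum_distrib_right[symmetric] q_vandermonde_blocks ..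
  also have "\<dots> = q_multinomial (Suc m) (\<Sum>u=1..s. N u) (k(1 := 0))"
    using step.hyps by (simp add: q_multinomial_Suc)
  finally show ?case .
qed

section \<open>Summing over the positions of the smallest letter\<close>

lemma sum_gap_upto:
  assumes "E \<subseteq> {1..n}" "i \<le> card E" "1 \<le> i"
  shows "(\<Sum>u=1..i. gap n E u) = nth_elem E i - i"
  using assms(3,2)
proof (induction i rule: dec_induct)
  case base
  then show ?case by (auto simp: gap_def)
next
  case (step i)
  have fin: "finite E" using assms(1) by (rule finite_subset) simp
  have "i \<le> nth_elem E i"
    using nth_elem_bounds(1)[OF assms(1)] step by simp
  moreover have "nth_elem E i < nth_elem E (Suc i)"
    using fin step by (intro nth_elem_Suc_less) auto
  moreover have "gap n E (Suc i) = nth_elem E (Suc i) - nth_elem E i - 1"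
    using step by (auto simp: gap_def)
  ultimately show ?case using step by simp
qed

lemma sum_gap:
  assumes "E \<subseteq> {1..n}" "card E = k"
  shows "(\<Sum>u=1..k+1. gap n E u) = n - k"
proof (cases "k = 0")
  case True
  then show ?thesis using assms by (simp add: gap_def)
next
  case False
  then have "gap n E (Suc k) = n - nth_elem E k"
    using assms by (simp add: gap_def)
  moreover have "(\<Sum>u=1..k. gap n E u) = nth_elem E k - k"
    using sum_gap_upto[of E n k] assms False by simp
  moreover have "k \<le> nth_elem E k" "nth_elem E k \<le> n"
    using nth_elem_bounds[of E n k] assms False by auto
  ultimately show ?thesis by simp
qed

lemma sum_weighted_eq_sum_partial:
  fixes g :: "nat \<Rightarrow> nat"
  shows "(\<Sum>u=1..k+1. (k + 1 - u) * g u) = (\<Sum>i=1..k. \<Sum>u=1..i. g u)"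
proof (induction k)
  case (Suc k)
  have "(\<Sum>u=1..Suc k + 1. (Suc k + 1 - u) * g u) =
      (\<Sum>u=1..k+1. (k + 1 - u) * g u + g u)"
    by (simp add: Suc_diff_le add_ac)
  then show ?case using Suc by (simp add: sum.distrib)
qed simp

text \<open>Both sides count the pairs of a position outside \<open>E\<close> and a later element of \<open>E\<close>: the left-hand
  side groups them by the block of the former, the right-hand side by the latter.\<close>

lemma sum_weighted_gap:
  assumes "E \<subseteq> {1..n}" "card E = k"
  shows "(\<Sum>u=1..k+1. (k + 1 - u) * gap n E u) = (\<Sum>i=1..k. nth_elem E i - i)"
  unfolding sum_weighted_eq_sum_partial
  using assms by (intro sum.cong sum_gap_upto) auto

text \<open>The definition of \<open>q_binomial\<close> weighs \<open>E\<close> by the positions outside \<open>E\<close> after each of its elements;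
  here it is the positions before. The latter weight satisfies the mirrored Pascal recursion, since
  a chosen last position \<open>n + 1\<close> has \<open>n - l\<close> positions outside \<open>E\<close> before it.\<close>

lemma q_binomial_eq_sum_area:
  "(\<Sum>E | E \<subseteq> {1..n} \<and> card E = k. qvar ^ (\<Sum>i=1..k. nth_elem E i - i)) = q_binomial n k"
proof (induction n arbitrary: k)
  case 0
  show ?case
  proof (cases k)
    case 0
    show ?thesis unfolding 0 q_binomial_def by simp
  next
    case (Suc l)
    then show ?thesis by (auto simp: q_binomial_eq_0 intro!: sum.neutral)
  qed
next
  case (Suc n)
  show ?case
  proof (cases k)
    case 0
    show ?thesis unfolding 0 q_binomial_def by simp
  next
    case k: (Suc l)
    have ins: "(\<Sum>i=1..Suc l. nth_elem (insert (Suc n) E) i - i) =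
        (n - l) + (\<Sum>i=1..l. nth_elem E i - i)"
      if "E \<subseteq> {1..n}" "card E = l" for E
      using that by (simp add: nth_elem_insert_max)
    have "(\<Sum>E | E \<subseteq> {1..Suc n} \<and> card E = Suc l. qvar ^ (\<Sum>i=1..Suc l. nth_elem E i - i)) =
        qvar ^ (n - l) * q_binomial n l + q_binomial n (Suc l)"
      unfolding sum_subsets_card_Suc Suc.IH
      unfolding Suc.IH[symmetric, of l] sum_distrib_left
      by (intro arg_cong2[where f = "(+)"] sum.cong refl)
        (simp only: mem_Collect_eq ins power_add)
    also have "\<dots> = q_binomial (Suc n) (Suc l)"
      by (cases "l \<le> n") (simp_all add: q_binomial_Suc_Suc' q_binomial_eq_0)
    finally show ?thesis using k by simp
  qed
qed

theorem proposition2p9: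
  fixes m n s :: nat and k :: "nat \<Rightarrow> nat"
  assumes "m \<ge> 1"
    and "(\<Sum>i=1..m. k i) = n"
    and "s = k 1 + 1"
  shows "q_multinomial m n k =
    (\<Sum>E | E \<subseteq> {1..n} \<and> card E = k 1.
      \<Sum>r\<in>families s m (gap n E) k.
        qvar ^ (\<Sum>u=1..s. \<Sum>v=2..m. f_exp (k 1) r u v) *
        (\<Prod>u=1..s. q_multinomial m (gap n E u) (\<lambda>v. if v = 1 then 0 else r u v)))"
proof -
  have "(\<Sum>i=1..m. k i) = k 1 + (\<Sum>v=2..m. k v)"
    using assms(1) by (simp add: sum.atLeast_Suc_atMost numeral_2_eq_2)
  then have rest: "n - k 1 = (\<Sum>v=2..m. k v)" using assms(2) by simp
  have expo: "(\<Sum>u=1..s. \<Sum>v=2..m. f_exp (k 1) r u v) =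
      (\<Sum>u=1..s. (k 1 + 1 - u) * N u) + cross_inversions s m r"
    if "r \<in> families s m N k" for r N
  proof -
    have "(\<Sum>v=2..m. f_exp (k 1) r u v) = (k 1 + 1 - u) * N u +
        (\<Sum>v=2..m. r u v * (\<Sum>i=u+1..s. \<Sum>j=2..v-1. r i j))" if "u \<in> {1..s}" for u
    proof -
      have "(\<Sum>v=2..m. r u v) = N u"
        using \<open>r \<in> families s m N k\<close> that by (simp add: families_def)
      then show ?thesis
        by (simp add: f_exp_def distrib_left sum.distrib assms(3) sum_distrib_right[symmetric] mult.commute)
    qed
    then show ?thesis by (simp add: cross_inversions_def sum.distrib)
  qed
  have upd: "(\<lambda>v. if v = 1 then 0 else f v) = f(1 := 0)" for f :: "nat \<Rightarrow> nat"
    by auto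
  have inner: "(\<Sum>r\<in>families s m (gap n E) k.
        qvar ^ (\<Sum>u=1..s. \<Sum>v=2..m. f_exp (k 1) r u v) *
        (\<Prod>u=1..s. q_multinomial m (gap n E u) (\<lambda>v. if v = 1 then 0 else r u v))) =
      qvar ^ (\<Sum>i=1..k 1. nth_elem E i - i) * q_multinomial m (n - k 1) (k(1 := 0))"
    if "E \<subseteq> {1..n}" "card E = k 1" for E
  proof -
    have tot: "(\<Sum>u=1..s. gap n E u) = n - k 1"
      using sum_gap[OF that] assms(3) by simp
    have wt: "(\<Sum>u=1..s. (k 1 + 1 - u) * gap n E u) = (\<Sum>i=1..k 1. nth_elem E i - i)"
      using sum_weighted_gap[OF that] assms(3) by simp
    have "(\<Sum>r\<in>families s m (gap n E) k.
        qvar ^ (\<Sum>u=1..s. \<Sum>v=2..m. f_exp (k 1) r u v) *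
        (\<Prod>u=1..s. q_multinomial m (gap n E u) ((r u)(1 := 0)))) =
      (\<Sum>r\<in>families s m (gap n E) k. qvar ^ (\<Sum>i=1..k 1. nth_elem E i - i) *
        (qvar ^ cross_inversions s m r *
          (\<Prod>u=1..s. q_multinomial m (gap n E u) ((r u)(1 := 0)))))"
      by (intro sum.cong refl) (simp only: expo wt power_add mult.assoc)
    also have "\<dots> = qvar ^ (\<Sum>i=1..k 1. nth_elem E i - i) *
        q_multinomial m (n - k 1) (k(1 := 0))"
      unfolding sum_distrib_left[symmetric]
      using q_multinomial_vandermonde[OF assms(1), of "gap n E" s k] rest unfolding tot by simp
    finally show ?thesis unfolding upd .
  qed
  have "q_multinomial m n k = q_binomial n (k 1) * q_multinomial m (n - k 1) (k(1 := 0))"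
    using assms(1,2) by (rule q_multinomial_split_first)
  also have "\<dots> = (\<Sum>E | E \<subseteq> {1..n} \<and> card E = k 1.
      qvar ^ (\<Sum>i=1..k 1. nth_elem E i - i) * q_multinomial m (n - k 1) (k(1 := 0)))"
    unfolding q_binomial_eq_sum_area[symmetric] sum_distrib_right ..
  finally have by_positions: "q_multinomial m n k = \<dots>" .
  show ?thesis
    unfolding by_positions by (intro sum.cong refl inner[symmetric]) auto
qed

end
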